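(* Let $G$ be a connected graph on $n$ vertices with Laplacian matrix $L$ and perturbation Laplacian matrix $\widehat{L}$, and let $L_{w}=L+\widehat{L}\varepsilon$ be the Laplacian matrix of the dual number weighted graph $G^{w}$. Then: (a) for any $\{1\}$-inverse $L_w^{\{1\}}$ of $L_w$ and any real $\{1\}$-inverse $L^{\{1\}}$ of $L$, $Kf(G^{w})=n\,\mathrm{tr}(L_{w}^{\{1\}})-\mathbf{1}^{T}L_{w}^{\{1\}}\mathbf{1}=n\,\mathrm{tr}(L^{\{1\}})-\mathbf{1}^{T}L^{\{1\}}\mathbf{1}-\big(n\,\mathrm{tr}(L^{\{1\}}\widehat{L}L^{\{1\}})-\mathbf{1}^{T}L^{\{1\}}\widehat{L}L^{\{1\}}\mathbf{1}\big)\varepsilon=Kf(G)-\big(n\,\mathrm{tr}(L^{\{1\}}\widehat{L}L^{\{1\}})-\mathbf{1}^{T}L^{\{1\}}\widehat{L}L^{\{1\}}\mathbf{1}\big)\varepsilon$; (b) $Kf(G^{w})=n\,\mathrm{tr}(L_{w}^{\dagger})=n\,\mathrm{tr}(L^{\dagger})-n\,\mathrm{tr}(L^{\dagger}\widehat{L}L^{\dagger})\varepsilon=Kf(G)-n\,\mathrm{tr}(L^{\dagger}\widehat{L}L^{\dagger})\varepsilon$.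
   Context: Dual numbers: $\mathbb{D}=\{a_s+a_d\varepsilon: a_s,a_d\in\mathbb{R}\}$ with $\varepsilon\neq 0$, $\varepsilon^2=0$. For a dual matrix $A$, a $\{1\}$-inverse is any $X$ with $AXA=A$; the Moore–Penrose inverse $A^{\dagger}$ is $X$ with $AXA=A$, $XAX=X$, $(AX)^T=AX$, $(XA)^T=XA$. $\mathbf{1}$ is the all-ones vector. Dual number weighted graph: given $G=(V,E)$, $V=[n]$, and reals $\widehat{a}_e$ ($e\in E$), edge $e$ gets conductance $w(e)=1+\widehat{a}_e\varepsilon$. $L=D-A$ is the Laplacian of $G$; the perturbation Laplacian is $\widehat{L}=\widehat{D}-\widehat{A}$ where $\widehat{A}_{ij}=\widehat{a}_e$ if $e=\{i,j\}\in E$ and $0$ otherwise, and $\widehat{D}$ is diagonal with $\widehat{D}_{ii}=\sum_j\widehat{A}_{ij}$; $L_w=L+\widehat{L}\varepsilon$. Resistance distance: $R_{ij}(G)$ is the effective resistance between $i,j$ with unit resistors on all edges of $G$; $R_{ij}(G^w)$ is the effective resistance in $G^w$: $R_{ii}(G^w)=0$, and for $i\ne j$, with net current $Y>0$ entering at $i$ and leaving at $j$, node potentials $v\in\mathbb{D}^n$ satisfy $L_wv=Y(\mathbf{1}_i-\mathbf{1}_j)$ and $R_{ij}(G^w)=(v_i-v_j)/Y$. Kirchhoff index: $Kf(G)=\sum_{i<j}R_{ij}(G)$ and $Kf(G^w)=\sum_{i<j}R_{ij}(G^w)$. *)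

theory Defs
  imports "HOL-Analysis.Analysis"
begin

section \<open>Dual numbers\<close>

datatype dual_num = Dual (std_part: real) (dual_part: real)

instantiation dual_num :: real_algebra_1
begin

definition zero_dual_num :: dual_num where "0 = Dual 0 0"
definition one_dual_num :: dual_num where "1 = Dual 1 0"
definition plus_dual_num :: "dual_num \<Rightarrow> dual_num \<Rightarrow> dual_num" where
  "x + y = Dual (std_part x + std_part y) (dual_part x + dual_part y)"
definition uminus_dual_num :: "dual_num \<Rightarrow> dual_num" where
  "- x = Dual (- std_part x) (- dual_part x)"
definition minus_dual_num :: "dual_num \<Rightarrow> dual_num \<Rightarrow> dual_num" where
  "x - y = Dual (std_part x - std_part y) (dual_part x - dual_part y)"
definition times_dual_num :: "dual_num \<Rightarrow> dual_num \<Rightarrow> dual_num" where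
  "x * y = Dual (std_part x * std_part y) (std_part x * dual_part y + dual_part x * std_part y)"
definition scaleR_dual_num :: "real \<Rightarrow> dual_num \<Rightarrow> dual_num" where
  "r *\<^sub>R x = Dual (r * std_part x) (r * dual_part x)"

instance
  by standard
    (simp_all add: zero_dual_num_def one_dual_num_def plus_dual_num_def uminus_dual_num_def
      minus_dual_num_def times_dual_num_def scaleR_dual_num_def dual_num.expand algebra_simps)

end

instance dual_num :: comm_ring_1
  by standard (simp_all add: times_dual_num_def one_dual_num_def plus_dual_num_def algebra_simps)

text \<open>A dual number is a unit iff its standard part is nonzero. On the other dual numbers the
  inverse is set to \<open>0\<close>.\<close>

instantiation dual_num :: inverse
begin

definition inverse_dual_num :: "dual_num \<Rightarrow> dual_num" where
  "inverse x = (if std_part x = 0 then 0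
     else Dual (1 / std_part x) (- dual_part x / (std_part x)\<^sup>2))"
definition divide_dual_num :: "dual_num \<Rightarrow> dual_num \<Rightarrow> dual_num" where
  "x div y = x * inverse (y :: dual_num)"

instance ..

end

definition eps :: dual_num where "eps = Dual 0 1"

lemma eps_nonzero: "eps \<noteq> 0"
  by (simp add: eps_def zero_dual_num_def)

lemma eps_squared: "eps ^ 2 = 0"
  by (simp add: eps_def zero_dual_num_def times_dual_num_def power2_eq_square)

lemma dual_num_decomp: "x = of_real (std_part x) + of_real (dual_part x) * eps"
  by (cases x)
    (simp add: eps_def of_real_def one_dual_num_def scaleR_dual_num_def times_dual_num_def
      plus_dual_num_def)

lemma dual_num_divide_mult_cancel:
  fixes x y :: dual_num
  assumes "std_part y \<noteq> 0"
  shows "x / y * y = x"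
  using assms
  by (cases x; cases y)
    (simp add: divide_dual_num_def inverse_dual_num_def times_dual_num_def field_simps
      power2_eq_square)


section \<open>Generalized inverses\<close>

definition is_one_inverse :: "'a::semiring_1 ^ 'n ^ 'm \<Rightarrow> 'a ^ 'm ^ 'n \<Rightarrow> bool" where
  "is_one_inverse A X \<longleftrightarrow> A ** X ** A = A"

definition is_MP_inverse :: "'a::semiring_1 ^ 'n ^ 'm \<Rightarrow> 'a ^ 'm ^ 'n \<Rightarrow> bool" where
  "is_MP_inverse A X \<longleftrightarrow>
     A ** X ** A = A \<and> X ** A ** X = X \<and>
     transpose (A ** X) = A ** X \<and> transpose (X ** A) = X ** A"

definition MP_inverse :: "'a::semiring_1 ^ 'n ^ 'm \<Rightarrow> 'a ^ 'm ^ 'n" where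
  "MP_inverse A = (THE X. is_MP_inverse A X)"

definition ones :: "'a::semiring_1 ^ 'n" where
  "ones = vec 1"

text \<open>The bilinear product \<open>u\<^sup>T v\<close>, needed over the dual numbers, where the library's inner
  product is not available.\<close>

definition dotp :: "'a::semiring_1 ^ 'n \<Rightarrow> 'a ^ 'n \<Rightarrow> 'a" where
  "dotp u v = (\<Sum>i\<in>UNIV. u $ i * v $ i)"


section \<open>Graphs, Laplacian matrices and resistance\<close>

text \<open>The vertex set is the whole finite type \<open>'n\<close>, so \<open>n = CARD('n)\<close>. The edge set is a set of
  two-element vertex sets.\<close>

definition simple_graph :: "'n set set \<Rightarrow> bool" where
  "simple_graph E \<longleftrightarrow> (\<forall>e\<in>E. card e = 2)"

definition connected_graph :: "'n set set \<Rightarrow> bool" where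
  "connected_graph E \<longleftrightarrow> (\<forall>i j. (i, j) \<in> {(u, v). {u, v} \<in> E}\<^sup>*)"

definition adjacency :: "'n set set \<Rightarrow> real ^ 'n ^ 'n" where
  "adjacency E = (\<chi> i j. if {i, j} \<in> E then 1 else 0)"

definition degree_matrix :: "'n set set \<Rightarrow> real ^ 'n ^ 'n" where
  "degree_matrix E = (\<chi> i j. if i = j then of_nat (card {k. {i, k} \<in> E}) else 0)"

definition laplacian :: "'n set set \<Rightarrow> real ^ 'n ^ 'n" where
  "laplacian E = degree_matrix E - adjacency E"

definition pert_adjacency :: "'n set set \<Rightarrow> ('n set \<Rightarrow> real) \<Rightarrow> real ^ 'n ^ 'n" where
  "pert_adjacency E a = (\<chi> i j. if {i, j} \<in> E then a {i, j} else 0)"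

definition pert_degree_matrix :: "'n set set \<Rightarrow> ('n set \<Rightarrow> real) \<Rightarrow> real ^ 'n ^ 'n" where
  "pert_degree_matrix E a =
     (\<chi> i j. if i = j then (\<Sum>k\<in>UNIV. pert_adjacency E a $ i $ k) else 0)"

definition pert_laplacian :: "'n set set \<Rightarrow> ('n set \<Rightarrow> real) \<Rightarrow> real ^ 'n ^ 'n" where
  "pert_laplacian E a = pert_degree_matrix E a - pert_adjacency E a"

definition dual_laplacian :: "'n set set \<Rightarrow> ('n set \<Rightarrow> real) \<Rightarrow> dual_num ^ 'n ^ 'n" where
  "dual_laplacian E a =
     (\<chi> i j. of_real (laplacian E $ i $ j) + of_real (pert_laplacian E a $ i $ j) * eps)"

definition resistance :: "'n::finite set set \<Rightarrow> 'n \<Rightarrow> 'n \<Rightarrow> real" where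
  "resistance E i j =
     (if i = j then 0
      else (THE r. \<exists>Y v. Y > 0 \<and> laplacian E *v v = Y *s (axis i 1 - axis j 1) \<and>
                         r = (v $ i - v $ j) / Y))"

text \<open>The net current \<open>Y\<close> ranges over the dual numbers with positive standard part. These include
  the positive reals, and are exactly the units among the lexicographically positive dual numbers, so that the division
  by \<open>Y\<close> is meaningful.\<close>

definition dual_resistance :: "'n::finite set set \<Rightarrow> ('n set \<Rightarrow> real) \<Rightarrow> 'n \<Rightarrow> 'n \<Rightarrow> dual_num" where
  "dual_resistance E a i j =
     (if i = j then 0
      else (THE r. \<exists>Y v. std_part Y > 0 \<and>
                         dual_laplacian E a *v v = Y *s (axis i 1 - axis j 1) \<and>
                         r = (v $ i - v $ j) / Y))"

text \<open>The linear order on the vertices only serves to sum over each pair \<open>i < j\<close> once.\<close>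

definition Kf :: "'n::{finite,linorder} set set \<Rightarrow> real" where
  "Kf E = (\<Sum>(i, j) | i < j. resistance E i j)"

definition dual_Kf :: "'n::{finite,linorder} set set \<Rightarrow> ('n set \<Rightarrow> real) \<Rightarrow> dual_num" where
  "dual_Kf E a = (\<Sum>(i, j) | i < j. dual_resistance E a i j)"

end

(* Write P for the projection I - J/n onto the vectors of sum zero. Connectedness makes L + J
   invertible, and X = P (L + J)^{-1} satisfies L X = X L = P, so X is the Moore-Penrose inverse
   of L. Since P fixes the perturbation Laplacian from both sides, X - X Lh X eps plays the same
   role for the dual Laplacian. Any matrix M with such an X has M w = c (e_i - e_j) only if
   w_i - w_j = c (e_i - e_j)^T X (e_i - e_j), and every {1}-inverse of M yields a solution w;
   hence resistances can be read off an arbitrary {1}-inverse, and summing them gives the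
   Kirchhoff index. Finally, L1 - L1 Lh L1 eps is a {1}-inverse of the dual Laplacian for every
   {1}-inverse L1 of L. *)

theory Submission
  imports Defs
begin

section \<open>Matrix algebra and Moore-Penrose inverses\<close>

lemma matrix_add_rdistrib: "(A + B) ** C = A ** C + B ** C"
  by (simp add: vec_eq_iff matrix_matrix_mult_def sum.distrib distrib_right)

lemma matrix_mul_minus_right:
  fixes A :: "'a::comm_ring_1 ^ 'n ^ 'm"
  shows "A ** (- B) = - (A ** B)"
  by (simp add: vec_eq_iff matrix_matrix_mult_def sum_negf)

lemma matrix_mul_minus_left:
  fixes A :: "'a::comm_ring_1 ^ 'n ^ 'm"
  shows "(- A) ** B = - (A ** B)"
  by (simp add: vec_eq_iff matrix_matrix_mult_def sum_negf)

text \<open>Symmetry of the four products gives \<open>A ** X = A ** Y\<close> and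
  \<open>X ** A = Y ** A\<close>; then
  \<open>X = X ** A ** X = X ** A ** Y = Y ** A ** Y = Y\<close>. Only commutative semiring laws
  occur, so the argument covers real and dual matrices alike.\<close>

lemma is_MP_inverse_unique:
  fixes A :: "'a::comm_semiring_1 ^ 'n ^ 'm"
  assumes "is_MP_inverse A X" and "is_MP_inverse A Y"
  shows "X = Y"
proof -
  have X: "A ** X ** A = A" "X ** A ** X = X" "transpose (A ** X) = A ** X"
      "transpose (X ** A) = X ** A"
    and Y: "A ** Y ** A = A" "Y ** A ** Y = Y" "transpose (A ** Y) = A ** Y"
      "transpose (Y ** A) = Y ** A"
    using assms by (auto simp: is_MP_inverse_def)
  have "A ** X = transpose (A ** Y ** A ** X)"
    using X(3) Y(1) by simp
  also have "\<dots> = transpose (A ** X) ** transpose (A ** Y)"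
    by (simp add: matrix_transpose_mul [symmetric] matrix_mul_assoc)
  also have "\<dots> = A ** Y"
    by (simp add: X Y matrix_mul_assoc)
  finally have AX: "A ** X = A ** Y" .
  have "X ** A = transpose (X ** (A ** Y ** A))"
    using X(4) Y(1) by simp
  also have "\<dots> = transpose (Y ** A) ** transpose (X ** A)"
    by (simp add: matrix_transpose_mul [symmetric] matrix_mul_assoc)
  also have "\<dots> = Y ** (A ** X ** A)"
    unfolding X(4) Y(4) by (simp add: matrix_mul_assoc)
  finally have XA: "X ** A = Y ** A"
    by (simp add: X)
  have "X = X ** (A ** X)"
    by (simp add: X matrix_mul_assoc)
  also have "\<dots> = X ** A ** Y"
    by (simp add: AX matrix_mul_assoc)
  also have "\<dots> = Y"
    by (simp add: XA Y)
  finally show ?thesis .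
qed

lemma MP_inverse_eqI:
  fixes A :: "'a::comm_semiring_1 ^ 'n ^ 'm"
  assumes "is_MP_inverse A X"
  shows "MP_inverse A = X"
  unfolding MP_inverse_def using assms is_MP_inverse_unique by blast

section \<open>Matrices invertible on the vectors of sum zero\<close>

text \<open>The scalar 1/n enters through \<open>of_real\<close>, so that the matrix also makes
  sense over the dual numbers, which are not a field.\<close>

definition centering :: "'a::real_algebra_1 ^ 'n ^ 'n" where
  "centering = (\<chi> i j. (if i = j then 1 else 0) - of_real (1 / of_nat CARD('n)))"

text \<open>\<open>M\<close> and \<open>X\<close> invert each other on the vectors of sum zero. The
  last two conditions give the remaining absorption laws:
  \<open>centering ** M = M ** X ** M = M\<close> and
  \<open>X ** centering = X ** M ** X = X\<close>.\<close>

definition is_centered_inverse ::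
    "'a::real_algebra_1 ^ 'n ^ 'n \<Rightarrow> 'a ^ 'n ^ 'n \<Rightarrow> bool" where
  "is_centered_inverse M X \<longleftrightarrow>
     M ** X = centering \<and> X ** M = centering \<and> M ** centering = M \<and> centering ** X = X"

lemma transpose_centering: "transpose centering = centering"
  by (simp add: centering_def transpose_def vec_eq_iff)

lemma matrix_mult_centering:
  fixes A :: "'a::real_algebra_1 ^ 'n ^ 'm"
  shows "(A ** centering) $ i $ j = A $ i $ j - (\<Sum>k\<in>UNIV. A $ i $ k) * of_real (1 / of_nat CARD('n))"
  by (simp add: matrix_matrix_mult_def centering_def right_diff_distrib sum_subtractf
      sum_distrib_right if_distrib [of "\<lambda>x. _ * x"] cong: if_cong)

lemma centering_mult_vector:
  fixes v :: "'a::real_algebra_1 ^ 'n"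
  shows "(centering *v v) $ i = v $ i - of_real (1 / of_nat CARD('n)) * (\<Sum>k\<in>UNIV. v $ k)"
  by (simp add: matrix_vector_mult_def centering_def left_diff_distrib sum_subtractf
      sum_distrib_left if_distrib [of "\<lambda>x. x * _"] cong: if_cong)

lemma centering_mult_axis_diff:
  "centering *v (axis i 1 - axis j 1) = (axis i 1 - axis j 1 :: 'a::real_algebra_1 ^ 'n)"
  by (simp add: vec_eq_iff centering_mult_vector sum_subtractf axis_def)

lemma centering_mult_ones: "centering *v (ones :: 'a::real_algebra_1 ^ 'n) = 0"
proof -
  have "of_real (1 / of_nat CARD('n)) * of_nat CARD('n) = (1 :: 'a)"
    by (metis of_nat_0_neq of_real_1 of_real_mult of_real_of_nat_eq nonzero_divide_eq_eq
        of_nat_eq_0_iff zero_less_card_finite less_numeral_extra(3))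
  then show ?thesis
    by (simp add: vec_eq_iff centering_mult_vector ones_def)
qed

lemma is_centered_inverse_MP:
  assumes "is_centered_inverse M X"
  shows "is_MP_inverse M X"
proof -
  have "M ** X ** M = M"
    using assms by (metis is_centered_inverse_def matrix_mul_assoc)
  then show ?thesis
    using assms by (simp add: is_centered_inverse_def is_MP_inverse_def transpose_centering)
qed

text \<open>Makes the terms \<open>dotp ones (X *v ones)\<close> vanish for Moore-Penrose
  inverses.\<close>

lemma is_centered_inverse_mult_ones:
  fixes M X :: "'a::{comm_ring_1, real_algebra_1} ^ 'n ^ 'n"
  assumes "is_centered_inverse M X"
  shows "X *v ones = 0"
proof -
  have "X = X ** centering"
    using assms by (metis is_centered_inverse_def matrix_mul_assoc)
  then have "X *v ones = X *v (centering *v ones)"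
    by (metis matrix_vector_mul_assoc)
  then show ?thesis
    by (simp add: centering_mult_ones)
qed

text \<open>Applying \<open>X\<close> to the equation determines \<open>centering *v w\<close>,
  which is \<open>w\<close> up to a common shift of all entries; differences of entries ignore the
  shift. This yields uniqueness of the resistance.\<close>

lemma potential_difference:
  fixes M X :: "'a::{comm_ring_1, real_algebra_1} ^ 'n ^ 'n"
  assumes "is_centered_inverse M X"
    and "M *v w = c *s (axis i 1 - axis j 1)"
  defines "u \<equiv> X *v (axis i 1 - axis j 1)"
  shows "w $ i - w $ j = c * (u $ i - u $ j)"
proof -
  have "centering *v w = X *v (M *v w)"
    using assms(1) by (simp add: is_centered_inverse_def matrix_vector_mul_assoc)
  also have "\<dots> = c *s u"
    unfolding assms(2) u_def
    by (simp add: vec_eq_iff matrix_vector_mult_def sum_distrib_left mult_ac del: vector_ssub_ldistrib)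
  finally have "(centering *v w) $ i - (centering *v w) $ j = c * u $ i - c * u $ j"
    by simp
  then show ?thesis
    by (simp add: centering_mult_vector right_diff_distrib)
qed

text \<open>Multiplying \<open>M ** Y ** M = M\<close> by \<open>X\<close> from the right gives
  \<open>M ** Y ** centering = centering\<close>, and \<open>centering\<close> fixes the vector in
  question. This yields existence of a potential for unit current.\<close>

lemma one_inverse_potential:
  fixes M X Y :: "'a::{comm_ring_1, real_algebra_1} ^ 'n ^ 'n"
  assumes "is_centered_inverse M X" and "is_one_inverse M Y"
  shows "M *v (Y *v (axis i 1 - axis j 1)) = axis i 1 - axis j 1"
proof -
  have "M ** Y ** centering = centering"
    using assms by (metis is_centered_inverse_def is_one_inverse_def matrix_mul_assoc)
  then show ?thesis
    by (metis centering_mult_axis_diff matrix_vector_mul_assoc)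
qed

lemma mult_axis_diff:
  fixes Y :: "'a::comm_ring_1 ^ 'n ^ 'n"
  shows "(Y *v (axis i 1 - axis j 1)) $ k = Y $ k $ i - Y $ k $ j"
  by (simp add: matrix_vector_mult_def axis_def right_diff_distrib sum_subtractf
      if_distrib [of "\<lambda>x. _ * x"] cong: if_cong)

section \<open>Resistances and the Kirchhoff index\<close>

lemma resistance_eq_one_inverse:
  assumes "is_centered_inverse (laplacian E) X" and "is_one_inverse (laplacian E) Y"
  shows "resistance E i j = Y $ i $ i - Y $ i $ j + (Y $ j $ j - Y $ j $ i)"
proof (cases "i = j")
  case False
  let ?v = "Y *v (axis i 1 - axis j 1)"
  have v: "laplacian E *v ?v = 1 *s (axis i 1 - axis j 1)"
    using one_inverse_potential[OF assms] by simp
  have "(THE r. \<exists>c v. c > 0 \<and> laplacian E *v v = c *s (axis i 1 - axis j 1) \<and>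
      r = (v $ i - v $ j) / c) = ?v $ i - ?v $ j"
  proof (rule the_equality)
    show "\<exists>c v. c > 0 \<and> laplacian E *v v = c *s (axis i 1 - axis j 1) \<and>
        ?v $ i - ?v $ j = (v $ i - v $ j) / c"
      by (rule exI[of _ 1], rule exI[of _ ?v]) (use v in auto)
  next
    fix r assume "\<exists>c v. c > 0 \<and> laplacian E *v v = c *s (axis i 1 - axis j 1) \<and>
        r = (v $ i - v $ j) / c"
    then show "r = ?v $ i - ?v $ j"
      using potential_difference[OF assms(1)] potential_difference[OF assms(1) v] by fastforce
  qed
  then show ?thesis
    using False by (simp add: resistance_def mult_axis_diff)
qed (simp add: resistance_def)

lemma dual_num_mult_divide_cancel:
  assumes "std_part y \<noteq> 0"
  shows "y * x / y = x"
  using assms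
  by (cases x; cases y)
    (simp add: divide_dual_num_def inverse_dual_num_def times_dual_num_def field_simps
      power2_eq_square)

lemma dual_resistance_eq_one_inverse:
  assumes "is_centered_inverse (dual_laplacian E a) X"
    and "is_one_inverse (dual_laplacian E a) Y"
  shows "dual_resistance E a i j = Y $ i $ i - Y $ i $ j + (Y $ j $ j - Y $ j $ i)"
proof (cases "i = j")
  case False
  let ?v = "Y *v (axis i 1 - axis j 1)"
  let ?u = "X *v (axis i 1 - axis j 1)"
  have v: "dual_laplacian E a *v ?v = 1 *s (axis i 1 - axis j 1)"
    using one_inverse_potential[OF assms] by simp
  have pos: "std_part 1 > 0"
    by (simp add: one_dual_num_def)
  have "(THE r. \<exists>c v. std_part c > 0 \<and> dual_laplacian E a *v v = c *s (axis i 1 - axis j 1) \<and>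
      r = (v $ i - v $ j) / c) = ?v $ i - ?v $ j"
  proof (rule the_equality)
    show "\<exists>c v. std_part c > 0 \<and> dual_laplacian E a *v v = c *s (axis i 1 - axis j 1) \<and>
        ?v $ i - ?v $ j = (v $ i - v $ j) / c"
      by (rule exI[of _ 1], rule exI[of _ ?v])
        (use v pos dual_num_mult_divide_cancel[of 1] in auto)
  next
    fix r assume "\<exists>c v. std_part c > 0 \<and> dual_laplacian E a *v v = c *s (axis i 1 - axis j 1) \<and>
        r = (v $ i - v $ j) / c"
    then obtain c w where c: "std_part c > 0"
      and w: "dual_laplacian E a *v w = c *s (axis i 1 - axis j 1)"
      and r: "r = (w $ i - w $ j) / c" by blast
    \<comment> \<open>Cancelling \<open>c\<close> requires it to be a unit, which a positive
      standard part ensures.\<close>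
    have "r = ?u $ i - ?u $ j"
      unfolding r potential_difference[OF assms(1) w]
      by (rule dual_num_mult_divide_cancel) (use c in simp)
    then show "r = ?v $ i - ?v $ j"
      using potential_difference[OF assms(1) v] by simp
  qed
  then show ?thesis
    using False by (simp add: dual_resistance_def mult_axis_diff)
qed (simp add: dual_resistance_def)

text \<open>The diagonal contributes nothing, and the pairs with j < i are the swapped pairs with i
  < j.\<close>

lemma sum_pairs_less:
  fixes h :: "'n::{finite,linorder} \<Rightarrow> 'n \<Rightarrow> 'a::comm_monoid_add"
  assumes "\<And>i. h i i = 0"
  shows "(\<Sum>(i, j) | i < j. h i j + h j i) = (\<Sum>i\<in>UNIV. \<Sum>j\<in>UNIV. h i j)"
proof -
  have swap: "(\<Sum>(i, j) | i < j. h j i) = (\<Sum>(i, j) | j < i. h i j)"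
    by (rule sum.reindex_bij_witness[of _ prod.swap prod.swap]) auto
  have "(\<Sum>i\<in>UNIV. \<Sum>j\<in>UNIV. h i j) = (\<Sum>(i, j)\<in>UNIV. h i j)"
    by (simp add: sum.cartesian_product)
  also have "\<dots> = (\<Sum>(i, j) \<in> {(i, j). i < j} \<union> {(i, j). j < i}. h i j)"
    by (rule sum.mono_neutral_right) (auto, metis assms neqE)
  also have "\<dots> = (\<Sum>(i, j) | i < j. h i j) + (\<Sum>(i, j) | j < i. h i j)"
    by (rule sum.union_disjoint) auto
  finally show ?thesis
    using swap by (simp add: sum.distrib case_prod_unfold)
qed

text \<open>Instance \<open>h i j = Y $ i $ i - Y $ i $ j\<close> of \<open>sum_pairs_less\<close>,
  which vanishes on the diagonal.\<close>

lemma sum_pairs_less_trace: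
  fixes Y :: "'a::comm_ring_1 ^ 'n::{finite,linorder} ^ 'n::{finite,linorder}"
  shows "(\<Sum>(i, j) | i < j. Y $ i $ i - Y $ i $ j + (Y $ j $ j - Y $ j $ i))
    = of_nat CARD('n) * trace Y - dotp ones (Y *v ones)"
  by (subst sum_pairs_less)
    (simp_all add: sum_subtractf trace_def dotp_def ones_def matrix_vector_mult_def
      sum_distrib_left)

lemma Kf_eq_one_inverse:
  fixes E :: "'n::{finite,linorder} set set"
  assumes "is_centered_inverse (laplacian E) X" and "is_one_inverse (laplacian E) Y"
  shows "Kf E = of_nat CARD('n) * trace Y - dotp ones (Y *v ones)"
  unfolding Kf_def resistance_eq_one_inverse[OF assms] by (rule sum_pairs_less_trace)

lemma dual_Kf_eq_one_inverse:
  fixes E :: "'n::{finite,linorder} set set"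
  assumes "is_centered_inverse (dual_laplacian E a) X"
    and "is_one_inverse (dual_laplacian E a) Y"
  shows "dual_Kf E a = of_nat CARD('n) * trace Y - dotp ones (Y *v ones)"
  unfolding dual_Kf_def dual_resistance_eq_one_inverse[OF assms] by (rule sum_pairs_less_trace)

section \<open>The Laplacian of a connected graph\<close>

text \<open>In this form all summands have the same sign at a maximum of \<open>v\<close>.\<close>

lemma laplacian_mult_vector:
  "(laplacian E *v v) $ i = (\<Sum>k\<in>UNIV. if {i, k} \<in> E then v $ i - v $ k else 0)"
proof -
  have "(\<Sum>k\<in>UNIV. if {i, k} \<in> E then v $ i - v $ k else 0)
      = (\<Sum>k\<in>UNIV. if {i, k} \<in> E then v $ i else 0) - (\<Sum>k\<in>UNIV. if {i, k} \<in> E then v $ k else 0)"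
    unfolding sum_subtractf [symmetric] by (rule sum.cong) auto
  also have "(\<Sum>k\<in>UNIV. if {i, k} \<in> E then v $ i else 0) = of_nat (card {k. {i, k} \<in> E}) * v $ i"
    by (simp flip: sum.inter_filter)
  finally show ?thesis
    by (simp add: laplacian_def degree_matrix_def adjacency_def matrix_vector_mult_def
        left_diff_distrib sum_subtractf if_distrib [of "\<lambda>x. x * _"] cong: if_cong)
qed

lemma transpose_laplacian: "transpose (laplacian E) = laplacian E"
  by (auto simp: laplacian_def degree_matrix_def adjacency_def transpose_def vec_eq_iff
      insert_commute)

lemma laplacian_mult_ones: "laplacian E *v ones = 0"
  unfolding vec_eq_iff laplacian_mult_vector by (simp add: ones_def vec_def cong: if_cong)

text \<open>Maximum principle: the neighbours of a maximum of \<open>v\<close> are again maxima.\<close>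

lemma laplacian_kernel_constant:
  fixes v :: "real ^ 'n"
  assumes "connected_graph E" and "laplacian E *v v = 0"
  obtains c where "\<And>i. v $ i = c"
proof -
  obtain m where m: "\<And>k. v $ k \<le> v $ m"
  proof -
    have "Max (range (($) v)) \<in> range (($) v)" by simp
    then obtain m where "v $ m = Max (range (($) v))" by (metis imageE)
    then have "v $ k \<le> v $ m" for k by simp
    then show ?thesis using that by blast
  qed
  have step: "v $ k = v $ m" if i: "v $ i = v $ m" and ik: "{i, k} \<in> E" for i k
  proof -
    \<comment> \<open>Since \<open>v\<close> is maximal at \<open>i\<close>, all summands are
      nonnegative, so a zero sum forces each of them to vanish.\<close>
    have "(\<Sum>k\<in>UNIV. if {i, k} \<in> E then v $ i - v $ k else 0) = 0"
      using assms(2) by (simp flip: laplacian_mult_vector)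
    then have "\<forall>k\<in>UNIV. (if {i, k} \<in> E then v $ i - v $ k else 0) = 0"
      by (subst (asm) sum_nonneg_eq_0_iff) (auto simp: i m)
    then show ?thesis
      using i ik by (metis UNIV_I eq_iff_diff_eq_0)
  qed
  have "v $ k = v $ m" for k
  proof -
    have "(m, k) \<in> {(u, v). {u, v} \<in> E}\<^sup>*"
      using assms(1) by (simp add: connected_graph_def)
    then show ?thesis
      by induction (auto intro: step)
  qed
  then show ?thesis using that by blast
qed

lemma laplacian_centered_inverse_exists:
  fixes E :: "'n::finite set set"
  assumes "connected_graph E"
  shows "\<exists>X. is_centered_inverse (laplacian E) X"
proof -
  let ?n = "real CARD('n)"
  let ?L = "laplacian E"
  define J :: "real ^ 'n ^ 'n" where "J = (\<chi> i j. 1)"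
  have row: "(\<Sum>k\<in>UNIV. ?L $ i $ k) = 0" for i
    using laplacian_mult_ones[of E] by (simp add: vec_eq_iff matrix_vector_mult_def ones_def)
  have sym: "?L $ i $ k = ?L $ k $ i" for i k
    using transpose_laplacian[of E] by (simp add: vec_eq_iff transpose_def)
  have col: "(\<Sum>k\<in>UNIV. ?L $ k $ i) = 0" for i
    using row[of i] by (simp add: sym[of i])
  have LJ: "?L ** J = 0" and JL: "J ** ?L = 0"
    by (simp_all add: vec_eq_iff matrix_matrix_mult_def J_def row col)
  have JJ: "J ** J = ?n *\<^sub>R J"
    by (simp add: vec_eq_iff matrix_matrix_mult_def J_def)
  have P: "centering = mat 1 - (1 / ?n) *\<^sub>R J"
    by (simp add: vec_eq_iff centering_def J_def mat_def)
  \<comment> \<open>Multiplying by \<open>J\<close> removes \<open>?L\<close> and leaves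
    \<open>J *v v = 0\<close>. Hence \<open>v\<close> lies in the kernel of \<open>?L\<close> and is
    constant; a constant vector with entry sum zero is zero.\<close>
  have inj: "v = 0" if v: "(?L + J) *v v = 0" for v
  proof -
    have "(J ** (?L + J)) *v v = 0"
      using v by (simp flip: matrix_vector_mul_assoc)
    then have "?n *\<^sub>R (J *v v) = 0"
      by (simp add: matrix_add_ldistrib JL JJ scaleR_matrix_vector_assoc)
    then have Jv: "J *v v = 0" by simp
    with v have "?L *v v = 0"
      by (simp add: matrix_vector_mult_add_rdistrib)
    then obtain c where c: "\<And>i. v $ i = c"
      using laplacian_kernel_constant[OF assms] by blast
    then show ?thesis
      using Jv by (simp add: vec_eq_iff matrix_vector_mult_def J_def)
  qed
  obtain K where K: "K ** (?L + J) = mat 1"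
    using inj matrix_left_invertible_ker[of "?L + J"] by blast
  then have K': "(?L + J) ** K = mat 1"
    by (simp add: matrix_left_right_inverse)
  \<comment> \<open>Knowing \<open>J ** K\<close> turns \<open>(?L + J) ** K = mat 1\<close> into a
    formula for \<open>?L ** K\<close>; the other order is treated alike.\<close>
  have "J = J ** ((?L + J) ** K)"
    by (simp add: K')
  also have "\<dots> = ?n *\<^sub>R (J ** K)"
    by (simp add: matrix_mul_assoc matrix_add_ldistrib JL JJ scalar_matrix_assoc)
  finally have JK: "J ** K = (1 / ?n) *\<^sub>R J"
    by (metis divide_inverse_commute mult.right_neutral scaleR_one scaleR_scaleR of_nat_eq_0_iff
        left_inverse zero_less_card_finite less_numeral_extra(3))
  have "J = (K ** (?L + J)) ** J"
    by (simp add: K)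
  also have "\<dots> = ?n *\<^sub>R (K ** J)"
    by (simp add: matrix_mul_assoc [symmetric] matrix_add_rdistrib LJ JJ matrix_scalar_ac scalar_matrix_assoc)
  finally have KJ: "K ** J = (1 / ?n) *\<^sub>R J"
    by (metis divide_inverse_commute mult.right_neutral scaleR_one scaleR_scaleR of_nat_eq_0_iff
        left_inverse zero_less_card_finite less_numeral_extra(3))
  have LK: "?L ** K = centering"
    using K' by (simp add: P matrix_add_rdistrib JK eq_diff_eq)
  have KL: "K ** ?L = centering"
    using K by (simp add: P matrix_add_ldistrib KJ eq_diff_eq)
  have LP: "?L ** centering = ?L"
    by (simp add: vec_eq_iff matrix_mult_centering row)
  \<comment> \<open>Multiply \<open>?L ** centering = ?L\<close> by \<open>K\<close> from the
    left.\<close>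
  have PP: "centering ** centering = (centering :: real ^ 'n ^ 'n)"
    by (metis KL LP matrix_mul_assoc)
  \<comment> \<open>\<open>K\<close> itself fails the condition \<open>centering ** X = X\<close>,
    because \<open>J ** K\<close> is nonzero; the extra projection removes this component.\<close>
  have "is_centered_inverse ?L (centering ** K)"
    unfolding is_centered_inverse_def by (metis LK KL LP PP matrix_mul_assoc)
  then show ?thesis by blast
qed

section \<open>Dual matrices\<close>

definition dual_matrix :: "real ^ 'n ^ 'm \<Rightarrow> real ^ 'n ^ 'm \<Rightarrow> dual_num ^ 'n ^ 'm" where
  "dual_matrix A B = (\<chi> i j. Dual (A $ i $ j) (B $ i $ j))"

lemma std_part_sum: "std_part (sum f S) = (\<Sum>x\<in>S. std_part (f x))"
  by (induction S rule: infinite_finite_induct) (auto simp: zero_dual_num_def plus_dual_num_def)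

lemma dual_part_sum: "dual_part (sum f S) = (\<Sum>x\<in>S. dual_part (f x))"
  by (induction S rule: infinite_finite_induct) (auto simp: zero_dual_num_def plus_dual_num_def)

lemma sum_Dual: "(\<Sum>x\<in>S. Dual (f x) (g x)) = Dual (sum f S) (sum g S)"
  by (simp add: dual_num.expand std_part_sum dual_part_sum)

lemma of_real_add_eps: "of_real x + of_real y * eps = Dual x y"
  using dual_num_decomp[of "Dual x y"] by simp

lemma of_real_diff_eps: "of_real x - of_real y * eps = Dual x (- y)"
  using of_real_add_eps[of x "- y"] by simp

lemma dual_matrix_mult:
  "dual_matrix A B ** dual_matrix C D = dual_matrix (A ** C) (A ** D + B ** C)"
  by (simp add: vec_eq_iff dual_matrix_def matrix_matrix_mult_def times_dual_num_def sum_Dual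
      sum.distrib)

lemma centering_dual: "centering = dual_matrix centering 0"
proof -
  have "of_real x = Dual x 0" for x
    using of_real_add_eps[of x 0] by simp
  then show ?thesis
    by (simp add: vec_eq_iff dual_matrix_def centering_def minus_dual_num_def
        zero_dual_num_def one_dual_num_def)
qed

lemma dual_laplacian_eq: "dual_laplacian E a = dual_matrix (laplacian E) (pert_laplacian E a)"
  by (simp add: dual_laplacian_def dual_matrix_def of_real_add_eps)

lemma trace_dual_matrix: "trace (dual_matrix A B) = Dual (trace A) (trace B)"
  by (simp add: trace_def dual_matrix_def sum_Dual)

lemma dotp_ones: "dotp ones (A *v ones) = (\<Sum>i\<in>UNIV. \<Sum>j\<in>UNIV. A $ i $ j)"
  by (simp add: dotp_def ones_def matrix_vector_mult_def)

lemma dotp_ones_dual_matrix: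
  "dotp ones (dual_matrix A B *v ones) = Dual (dotp ones (A *v ones)) (dotp ones (B *v ones))"
  by (simp add: dotp_ones dual_matrix_def sum_Dual)

lemma of_nat_mult_Dual: "of_nat n * Dual x y = Dual (of_nat n * x) (of_nat n * y)"
proof -
  have "of_nat n * Dual x y = real n *\<^sub>R Dual x y"
    by (simp add: scaleR_conv_of_real)
  then show ?thesis by (simp add: scaleR_dual_num_def)
qed

section \<open>Lifting generalized inverses to the dual Laplacian\<close>

lemma pert_laplacian_mult_centering: "pert_laplacian E a ** centering = pert_laplacian E a"
  by (simp add: vec_eq_iff matrix_mult_centering pert_laplacian_def pert_degree_matrix_def
      sum_subtractf)

lemma centering_mult_pert_laplacian: "centering ** pert_laplacian E a = pert_laplacian E a"
proof -
  have "transpose (pert_laplacian E a) = pert_laplacian E a"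
    by (auto simp: vec_eq_iff transpose_def pert_laplacian_def pert_degree_matrix_def
        pert_adjacency_def insert_commute)
  then show ?thesis
    by (metis pert_laplacian_mult_centering matrix_transpose_mul transpose_centering)
qed

text \<open>First-order expansion of an inverse: the dual part of the product is
  \<open>H ** X - L ** (X ** H ** X)\<close>, which vanishes because
  \<open>L ** X = centering\<close> fixes \<open>H\<close>; the other order is symmetric.\<close>

lemma is_centered_inverse_dual:
  assumes "is_centered_inverse L X" and "H ** centering = H" and "centering ** H = H"
  shows "is_centered_inverse (dual_matrix L H) (dual_matrix X (- (X ** H ** X)))"
proof -
  have "L ** X = centering" "X ** L = centering" "L ** centering = L" "centering ** X = X"
    using assms(1) by (auto simp: is_centered_inverse_def)
  moreover from this have "L ** (X ** H ** X) = H ** X"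
    by (metis assms(3) matrix_mul_assoc)
  moreover have "X ** H ** X ** L = X ** H"
    by (metis assms(2) calculation(2) matrix_mul_assoc)
  moreover have "centering ** (X ** H ** X) = X ** H ** X"
    by (metis calculation(4) matrix_mul_assoc)
  ultimately show ?thesis
    unfolding is_centered_inverse_def centering_dual
    by (simp add: dual_matrix_mult matrix_mul_minus_left matrix_mul_minus_right assms)
qed

text \<open>Although \<open>Y\<close> is arbitrary, \<open>L ** Y\<close> fixes \<open>H\<close>:
  from \<open>H = L ** X ** H\<close> it follows that
  \<open>L ** Y ** H = L ** Y ** L ** X ** H = H\<close>.\<close>

lemma is_one_inverse_dual:
  assumes "is_centered_inverse L X" and "is_one_inverse L Y"
    and "H ** centering = H" and "centering ** H = H"
  shows "is_one_inverse (dual_matrix L H) (dual_matrix Y (- (Y ** H ** Y)))"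
proof -
  have LX: "L ** X = centering" "X ** L = centering" and Y: "L ** Y ** L = L"
    using assms(1,2) by (auto simp: is_centered_inverse_def is_one_inverse_def)
  have LYH: "L ** Y ** H = H"
    by (metis LX(1) Y assms(4) matrix_mul_assoc)
  have HYL: "H ** Y ** L = H"
    by (metis LX(2) Y assms(3) matrix_mul_assoc)
  \<comment> \<open>Hence the product of the first two dual factors has dual part zero, and the
    third factor leaves \<open>L ** Y ** L = L\<close> and \<open>L ** Y ** H = H\<close>.\<close>
  have "L ** (Y ** H ** Y) = H ** Y"
    by (metis LYH matrix_mul_assoc)
  then show ?thesis
    by (simp add: is_one_inverse_def dual_matrix_mult matrix_mul_minus_right Y LYH)
qed


section \<open>Both formulas for the Kirchhoff index\<close>

theorem theorem3p4:
  fixes E :: "'n::{finite,linorder} set set" and a :: "'n set \<Rightarrow> real"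
    and L Lh :: "((real, 'n) vec, 'n) vec" and Lw :: "((dual_num, 'n) vec, 'n) vec"
  assumes "simple_graph E" and "connected_graph E"
    and L: "L = laplacian E" and Lh: "Lh = pert_laplacian E a" and Lw: "Lw = dual_laplacian E a"
  shows
    "(\<forall>(Lw1 :: ((dual_num, 'n) vec, 'n) vec) (L1 :: ((real, 'n) vec, 'n) vec).
        is_one_inverse Lw Lw1 \<and> is_one_inverse L L1 \<longrightarrow>
        dual_Kf E a = of_nat CARD('n) * trace Lw1 - dotp ones (Lw1 *v ones) \<and>
        of_nat CARD('n) * trace Lw1 - dotp ones (Lw1 *v ones)
          = of_real (of_nat CARD('n) * trace L1 - dotp ones (L1 *v ones))
            - of_real (of_nat CARD('n) * trace (L1 ** Lh ** L1)
                        - dotp ones ((L1 ** Lh ** L1) *v ones)) * eps \<and>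
        of_real (of_nat CARD('n) * trace L1 - dotp ones (L1 *v ones))
            - of_real (of_nat CARD('n) * trace (L1 ** Lh ** L1)
                        - dotp ones ((L1 ** Lh ** L1) *v ones)) * eps
          = of_real (Kf E)
            - of_real (of_nat CARD('n) * trace (L1 ** Lh ** L1)
                        - dotp ones ((L1 ** Lh ** L1) *v ones)) * eps)
     \<and>
     (dual_Kf E a = of_nat CARD('n) * trace (MP_inverse Lw) \<and>
      of_nat CARD('n) * trace (MP_inverse Lw)
        = of_real (of_nat CARD('n) * trace (MP_inverse L))
          - of_real (of_nat CARD('n) * trace (MP_inverse L ** Lh ** MP_inverse L)) * eps \<and>
      of_real (of_nat CARD('n) * trace (MP_inverse L))
          - of_real (of_nat CARD('n) * trace (MP_inverse L ** Lh ** MP_inverse L)) * eps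
        = of_real (Kf E)
          - of_real (of_nat CARD('n) * trace (MP_inverse L ** Lh ** MP_inverse L)) * eps)"
proof -
  let ?n = "of_nat CARD('n)"
  obtain X where X: "is_centered_inverse L X"
    using laplacian_centered_inverse_exists assms by blast
  have Lw_eq: "Lw = dual_matrix L Lh"
    by (simp add: L Lh Lw dual_laplacian_eq)
  have H: "Lh ** centering = Lh" "centering ** Lh = Lh"
    by (simp_all add: Lh pert_laplacian_mult_centering centering_mult_pert_laplacian)
  let ?Xw = "dual_matrix X (- (X ** Lh ** X))"
  have Xw: "is_centered_inverse Lw ?Xw"
    unfolding Lw_eq by (rule is_centered_inverse_dual[OF X H])
  have Kw: "dual_Kf E a = ?n * trace Y - dotp ones (Y *v ones)" if "is_one_inverse Lw Y" for Y
    using dual_Kf_eq_one_inverse Xw that unfolding Lw by blast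
  have K: "Kf E = ?n * trace Y - dotp ones (Y *v ones)" if "is_one_inverse L Y" for Y
    using Kf_eq_one_inverse X that unfolding L by blast
  \<comment> \<open>\<open>Kw\<close> applied to the lift of \<open>Y\<close>, split into standard
    and dual parts. Comparing this with \<open>Kw\<close> for an unrelated {1}-inverse of
    \<open>Lw\<close> links the two independent choices in (a).\<close>
  have expand: "dual_Kf E a = of_real (?n * trace Y - dotp ones (Y *v ones))
      - of_real (?n * trace (Y ** Lh ** Y) - dotp ones ((Y ** Lh ** Y) *v ones)) * eps"
    if Y: "is_one_inverse L Y" for Y
  proof -
    have neg: "trace (- B) = - trace B" "dotp ones (- B *v ones) = - dotp ones (B *v ones)"
      for B :: "((real, 'n) vec, 'n) vec"
      by (simp_all add: trace_def dotp_ones sum_negf)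
    have "is_one_inverse Lw (dual_matrix Y (- (Y ** Lh ** Y)))"
      unfolding Lw_eq by (rule is_one_inverse_dual[OF X Y H])
    then show ?thesis
      unfolding of_real_diff_eps
      by (simp add: Kw trace_dual_matrix dotp_ones_dual_matrix of_nat_mult_Dual
          minus_dual_num_def neg)
  qed
  have MP: "MP_inverse L = X" and MPw: "MP_inverse Lw = ?Xw"
    using X Xw by (auto intro!: MP_inverse_eqI is_centered_inverse_MP)
  have one: "is_one_inverse L X" "is_one_inverse Lw ?Xw"
    using is_centered_inverse_MP[OF X] is_centered_inverse_MP[OF Xw]
    by (auto simp: is_MP_inverse_def is_one_inverse_def)
  \<comment> \<open>With these terms gone, (b) is the case of (a) where both {1}-inverses are
    Moore-Penrose inverses.\<close>
  have dotp_0: "dotp ones (X *v ones) = 0" "dotp ones (?Xw *v ones) = 0"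
    "dotp ones ((X ** Lh ** X) *v ones) = 0"
    unfolding matrix_vector_mul_assoc [symmetric]
    by (simp_all add: is_centered_inverse_mult_ones[OF X] is_centered_inverse_mult_ones[OF Xw]
        dotp_def)
  have "dual_Kf E a = ?n * trace ?Xw"
    using Kw[OF one(2)] by (simp only: dotp_0 diff_zero)
  moreover have "Kf E = ?n * trace X"
    using K[OF one(1)] by (simp only: dotp_0 diff_zero)
  moreover have "dual_Kf E a = of_real (?n * trace X)
      - of_real (?n * trace (X ** Lh ** X)) * eps"
    using expand[OF one(1)] by (simp only: dotp_0 diff_zero)
  ultimately show ?thesis
    unfolding MP MPw using Kw K expand by metis
qed

end
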